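(* There exists an infinite tree whose set of nodes is in bijection with the set $\mathbf{N}$.
   Context: $\mathbf{N}=\{0,1,2,\ldots\}$ is the set of integers. A tree is called bijective with a set when its set of nodes is in bijection with that set. *)

theory Defs
  imports "Graph_Theory.Digraph_Component"
begin

text \<open>
  An undirected simple graph is modelled, as for the locale \<open>graph\<close> of the library but without the
  finiteness conditions of that locale, as a symmetric digraph without loops and parallel arcs: an
  edge between \<open>u\<close> and \<open>v\<close> is the pair of arcs from \<open>u\<close> to \<open>v\<close> and from \<open>v\<close> to \<open>u\<close>.
\<close>

locale undirected_graph = loopfree_digraph G + nomulti_digraph G + sym_digraph G
  for G :: "('a, 'b) pre_digraph" (structure)

text \<open>
  The constant \<open>tree\<close> of the library is not the notion for undirected graphs: it excludes only
  directed cycles, and among these also the closed walk along \<open>u, v, u\<close>, so that it rejects every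
  symmetric digraph with an arc and accepts, for instance, every connected acyclic digraph.
  In a simple undirected graph, the cycles are the closed walks of length at least 3 without
  repeated vertices. The constant \<open>connected\<close> includes that the vertex set is nonempty.
\<close>

locale undirected_tree = undirected_graph G
  for G :: "('a, 'b) pre_digraph" (structure) +
  assumes connected: "Digraph_Component.connected G"
    and acyclic: "\<nexists>p. cycle p \<and> length p \<ge> 3"

end

theory Submission
  imports Defs
begin

text \<open>
  The infinite star is such a tree: its vertices are all natural numbers, and its edges join the
  centre \<open>0\<close> to every other number. It is connected since each vertex reaches the centre and is
  reached from it in at most one step. It has no cycle since every arc has the centre as exactly
  one of its ends: a walk passes through the centre at every second vertex, so that a closed walk
  of length at least 3 (necessarily even, hence at least 4) visits the centre more than once.
\<close>

definition infinite_star :: "(nat, nat \<times> nat) pre_digraph" where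
  "infinite_star = \<lparr>verts = UNIV, arcs = {(u, v). (u = 0) \<noteq> (v = 0)}, tail = fst, head = snd\<rparr>"

lemma infinite_star_simps [simp]:
  "verts infinite_star = UNIV"
  "arcs infinite_star = {(u, v). (u = 0) \<noteq> (v = 0)}"
  "tail infinite_star = fst"
  "head infinite_star = snd"
  by (simp_all add: infinite_star_def)

lemma arcs_ends_infinite_star [simp]:
  "arcs_ends infinite_star = {(u, v). (u = 0) \<noteq> (v = 0)}"
  by (auto simp: arcs_ends_def arc_to_ends_def)

lemma undirected_graph_infinite_star: "undirected_graph infinite_star"
  by unfold_locales (auto simp: arc_to_ends_def symmetric_def intro!: symI)

lemma connected_infinite_star: "Digraph_Component.connected infinite_star"
proof -
  interpret undirected_graph infinite_star
    by (rule undirected_graph_infinite_star)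
  have to_centre: "u \<rightarrow>\<^sup>*\<^bsub>infinite_star\<^esub> 0" for u
    by (cases "u = 0") (auto intro: reachable_adjI)
  have from_centre: "0 \<rightarrow>\<^sup>*\<^bsub>infinite_star\<^esub> v" for v
    by (cases "v = 0") (auto intro: reachable_adjI)
  show ?thesis
    unfolding connected_def
    by (rule strongly_connectedI)
      (auto intro: reachable_mk_symmetricI reachable_trans[OF to_centre from_centre])
qed

lemma acyclic_infinite_star:
  assumes "pre_digraph.cycle infinite_star p"
  shows "length p < 3"
proof (rule ccontr)
  interpret undirected_graph infinite_star
    by (rule undirected_graph_infinite_star)
  assume "\<not> length p < 3"
  then obtain e1 e2 e3 es where p: "p = e1 # e2 # e3 # es"
    by (auto simp: not_less numeral_3_eq_3 Suc_le_length_iff)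
  obtain a where "awalk a p a" and "distinct (tl (awalk_verts a p))"
    using assms unfolding cycle_def by blast
  \<comment> \<open>The second, third and fourth vertices are distinct and joined by two arcs, so that the third
      one is the centre. If the walk closes at the fourth vertex, its first arc misses the centre;
      otherwise its fourth arc leads back to the centre.\<close>
  show False
    using \<open>awalk a p a\<close> \<open>distinct (tl (awalk_verts a p))\<close>
    unfolding p
    by (cases es) (auto simp: awalk_Cons_iff dest: hd_in_awalk_verts(1))
qed

theorem proposition1:
  shows "\<exists>T :: (nat, nat \<times> nat) pre_digraph.
    undirected_tree T \<and> infinite (verts T) \<and>
    (\<exists>f. bij_betw f (verts T) (UNIV :: nat set))"
proof (intro exI conjI)
  show "undirected_tree infinite_star"
    unfolding undirected_tree_def undirected_tree_axioms_def
    using undirected_graph_infinite_star connected_infinite_star acyclic_infinite_star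
    by (auto simp: not_le[symmetric])
  show "infinite (verts infinite_star)"
    by simp
  show "bij_betw id (verts infinite_star) UNIV"
    by simp
qed

end
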